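(* Every triangle-free graph $G$ satisfies $$\chi(G) \leq \frac{Z(G)}{2}+2.$$
   Context: All graphs are finite, undirected and simple. $\chi(G)$ denotes the chromatic number of $G$. A graph is triangle-free if it contains no $K_3$. Zero forcing number: let each vertex of $G$ be initially coloured black or white. Colour-change rule: if a black vertex $u$ has exactly one white neighbour $v$, then $v$ may be recoloured black ($u$ forces $v$). A set $B\subseteq V(G)$ is a zero forcing set if, starting with exactly the vertices of $B$ black, repeated application of the colour-change rule makes every vertex of $G$ black. The zero forcing number $Z(G)$ is the minimum size of a zero forcing set of $G$. *)

theory Defs
  imports Complex_Main "Graph_Theory.Graph_Theory"
begin

text \<open>
  Graphs are those of the locale \<^locale>\<open>graph\<close>: finite, loop-free, without parallel arcs, and
  symmetric, an undirected edge being a pair of opposite arcs.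
\<close>

definition triangle_free :: "('a, 'b) pre_digraph \<Rightarrow> bool" where
  "triangle_free G \<longleftrightarrow> \<not> (\<exists>H. subgraph H G \<and> K\<^bsub>3\<^esub> H)"

definition proper_colouring :: "('a, 'b) pre_digraph \<Rightarrow> nat \<Rightarrow> ('a \<Rightarrow> nat) \<Rightarrow> bool" where
  "proper_colouring G k c \<longleftrightarrow>
     c ` verts G \<subseteq> {..<k} \<and> (\<forall>u v. u \<rightarrow>\<^bsub>G\<^esub> v \<longrightarrow> c u \<noteq> c v)"

definition chromatic_number :: "('a, 'b) pre_digraph \<Rightarrow> nat" where
  "chromatic_number G = (LEAST k. \<exists>c. proper_colouring G k c)"

text \<open>One application of the colour-change rule; the arguments are the sets of black vertices
  before and after.\<close>

inductive colour_change :: "('a, 'b) pre_digraph \<Rightarrow> 'a set \<Rightarrow> 'a set \<Rightarrow> bool"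
  for G :: "('a, 'b) pre_digraph" where
  force: "u \<in> S \<Longrightarrow> {w. u \<rightarrow>\<^bsub>G\<^esub> w \<and> w \<notin> S} = {v} \<Longrightarrow> colour_change G S (insert v S)"

definition zero_forcing_set :: "('a, 'b) pre_digraph \<Rightarrow> 'a set \<Rightarrow> bool" where
  "zero_forcing_set G B \<longleftrightarrow> B \<subseteq> verts G \<and> (colour_change G)\<^sup>*\<^sup>* B (verts G)"

definition zero_forcing_number :: "('a, 'b) pre_digraph \<Rightarrow> nat" where
  "zero_forcing_number G = (LEAST k. \<exists>B. zero_forcing_set G B \<and> card B = k)"

end

theory Submission
  imports Defs
begin

text \<open>
  The graph is coloured along a zero forcing process, with \<open>k = Z div 2 + 2\<close> colours, where \<open>Z\<close> is
  the zero forcing number. The black vertices that still have a white neighbour lie in a frontier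
  of at most \<open>Z \<le> 2 * k - 3\<close> vertices: when \<open>u\<close> forces \<open>v\<close>, all neighbours of \<open>u\<close> have become
  black, so \<open>v\<close> takes the place of \<open>u\<close>. Hence the already coloured neighbours of a new vertex lie in
  the frontier, and they are independent because there are no triangles.

  A free colour for the new vertex exists as long as every independent subset of the frontier
  shows fewer than \<open>k\<close> colours (\<open>colour_poor\<close>). The difficulty is to choose that colour so that the
  invariant survives (\<open>colour_poor_extend\<close>). Suppose that it cannot be done for a new vertex \<open>v\<close>
  with set of neighbours \<open>N\<close> in the frontier. Then every colour \<open>a\<close> missing on \<open>N\<close> has a witness: an
  independent set \<open>J a\<close> of frontier vertices outside \<open>N\<close> that shows exactly the colours other than
  \<open>a\<close>. All these witnesses together have few vertices, since the frontier has at most \<open>2 * k - 3\<close>.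
  The exchange argument \<open>rainbow_exchange\<close> then assembles from them an independent set with all \<open>k\<close>
  colours, which contradicts the invariant.
\<close>

section \<open>Independent sets and their colours\<close>

definition independent_set :: "('a \<Rightarrow> 'a \<Rightarrow> bool) \<Rightarrow> 'a set \<Rightarrow> bool" where
  "independent_set E I \<longleftrightarrow> (\<forall>x\<in>I. \<forall>y\<in>I. \<not> E x y)"

definition colour_poor :: "('a \<Rightarrow> 'a \<Rightarrow> bool) \<Rightarrow> nat \<Rightarrow> ('a \<Rightarrow> nat) \<Rightarrow> 'a set \<Rightarrow> bool" where
  "colour_poor E k c F \<longleftrightarrow> (\<forall>I\<subseteq>F. independent_set E I \<longrightarrow> card (c ` I) < k)"

lemma independent_set_subset: "independent_set E J \<Longrightarrow> I \<subseteq> J \<Longrightarrow> independent_set E I"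
  unfolding independent_set_def by blast

lemma colour_poor_subset: "colour_poor E k c F \<Longrightarrow> F' \<subseteq> F \<Longrightarrow> colour_poor E k c F'"
  unfolding colour_poor_def by blast

text \<open>
  If every colour in \<open>A\<close> occurred at least twice in \<open>U\<close>, and every other colour of \<open>C\<close> at least once,
  then \<open>U\<close> would have at least \<open>card C + card A\<close> elements.
\<close>

lemma singleton_fibre:
  assumes "finite U" "finite C" "c ` U = C" "A \<subseteq> C" "card U < card C + card A"
  obtains a x where "a \<in> A" "{y \<in> U. c y = a} = {x}"
proof -
  have "\<exists>a\<in>A. card {y \<in> U. c y = a} = 1"
  proof (rule ccontr)
    assume none: "\<not> ?thesis"
    have "card C + card A = (\<Sum>a\<in>C. 1 + (if a \<in> A then 1 else 0))"
      using assms(2,4) by (simp only: sum.distrib) (simp add: sum.If_cases Int_absorb1)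
    also have "\<dots> \<le> (\<Sum>a\<in>C. card {y \<in> U. c y = a})"
    proof (rule sum_mono)
      fix a assume "a \<in> C"
      then have "card {y \<in> U. c y = a} \<noteq> 0"
        using assms(1,3) by auto
      moreover have "a \<in> A \<Longrightarrow> card {y \<in> U. c y = a} \<noteq> 1"
        using none by blast
      ultimately show "1 + (if a \<in> A then 1 else 0) \<le> card {y \<in> U. c y = a}"
        by auto
    qed
    also have "\<dots> = card U"
      using sum.group[of U C c "\<lambda>_. 1::nat"] assms(1-3) by simp
    finally show False using assms(5) by simp
  qed
  then show thesis using that by (auto simp: card_1_singleton_iff)
qed

text \<open>
  Take a minimal nonempty set \<open>A\<close> for which the bound on the size of the union \<open>U\<close> of the \<open>J a\<close>
  holds. Removing a colour from \<open>A\<close> lowers the right-hand side by one, so by minimality it cannot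
  lower the size of \<open>U\<close>: each vertex of \<open>J a\<close> lies in some \<open>J b\<close> with \<open>b \<noteq> a\<close>. On the other hand, \<open>U\<close>
  is so small that some colour \<open>a \<in> A\<close> occurs on just one vertex \<open>x\<close> of \<open>U\<close>, and this \<open>x\<close> must
  belong to every \<open>J b\<close> with \<open>b \<noteq> a\<close>. So \<open>x\<close> shares an independent set with each vertex of \<open>J a\<close>,
  and adding \<open>x\<close> to \<open>J a\<close> supplies the one missing colour.
\<close>

lemma rainbow_exchange:
  assumes "finite C" and "A \<subseteq> C" and "A \<noteq> {}"
    and J: "\<And>a. a \<in> A \<Longrightarrow> finite (J a) \<and> independent_set E (J a) \<and> c ` J a = C - {a}"
    and "card (\<Union>a\<in>A. J a) + 3 \<le> card C + card A"
  shows "\<exists>I \<subseteq> (\<Union>a\<in>A. J a). independent_set E I \<and> c ` I = C"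
proof -
  have "finite A" using assms(1,2) finite_subset by blast
  then show ?thesis using assms(2-)
  proof (induction A rule: finite_psubset_induct)
    case (psubset A)
    let ?U = "\<lambda>A. \<Union>a\<in>A. J a"
    have finU: "finite (?U B)" if "B \<subseteq> A" for B
      using that psubset.hyps psubset.prems(3) by (auto intro: finite_subset)
    \<comment> \<open>This is where the slack \<open>3\<close> is needed: with slack \<open>2\<close> a single colour can meet the bound.\<close>
    have two: "A \<noteq> {a}" for a
    proof
      assume A: "A = {a}"
      have "card C - 1 = card (c ` J a)"
        using psubset.prems(1,3) A by (simp add: card_Diff_singleton)
      also have "\<dots> \<le> card (J a)" using psubset.prems(3) A by (intro card_image_le) simp
      finally show False using psubset.prems(4) A by simp
    qed
    have other: "\<exists>b\<in>A. b \<noteq> a" for a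
      using two[of a] subset_singletonD[of A a] psubset.prems(2) by blast
    show ?case
    proof (cases "\<exists>a\<in>A. card (?U (A - {a})) + 3 \<le> card C + card (A - {a})")
      case True
      then obtain a where a: "a \<in> A" "card (?U (A - {a})) + 3 \<le> card C + card (A - {a})"
        by blast
      have "\<exists>I \<subseteq> ?U (A - {a}). independent_set E I \<and> c ` I = C"
      proof (rule psubset.IH)
        show "A - {a} \<noteq> {}" using other[of a] by blast
      qed (use a psubset.prems in auto)
      then obtain I where I: "I \<subseteq> ?U (A - {a})" "independent_set E I" "c ` I = C"
        by (elim exE conjE)
      then have "I \<subseteq> ?U A" by auto
      then show ?thesis using I(2,3) by (intro exI conjI)
    next
      case False
      have covered: "?U (A - {a}) = ?U A" if "a \<in> A" for a
      proof (rule card_subset_eq)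
        have "card (?U (A - {a})) + 3 > card C + card (A - {a})"
          using False that by auto
        moreover have "card (A - {a}) = card A - 1" "card A > 0"
          using that psubset.hyps by (auto simp: card_gt_0_iff)
        moreover have "card (?U (A - {a})) \<le> card (?U A)"
          by (rule card_mono) (use finU in auto)
        ultimately show "card (?U (A - {a})) = card (?U A)"
          using psubset.prems(4) by linarith
      qed (use finU in auto)
      have "c ` ?U A = (\<Union>a\<in>A. C - {a})"
        using psubset.prems(3) by (auto simp: image_UN)
      also have "\<dots> = C"
      proof (intro equalityI subsetI)
        fix a assume "a \<in> C"
        then show "a \<in> (\<Union>b\<in>A. C - {b})" using other[of a] by auto
      qed auto
      finally have "c ` ?U A = C" .
      then obtain a x where a: "a \<in> A" and x: "{y \<in> ?U A. c y = a} = {x}"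
        using singleton_fibre[of "?U A" C c A] finU[of A] psubset.prems(1,4) assms(1) by auto
      have x': "x \<in> ?U A" "c x = a" using x by auto
      have x_in: "x \<in> J b" if "b \<in> A" "b \<noteq> a" for b
      proof -
        have "a \<in> c ` J b" using psubset.prems(1,3) that a by auto
        then obtain y where "y \<in> J b" "c y = a" by auto
        then have "y \<in> {y \<in> ?U A. c y = a}" using that by auto
        then show ?thesis using \<open>y \<in> J b\<close> unfolding x by simp
      qed
      have nonadj: "\<not> E x y \<and> \<not> E y x" if "y \<in> J a" for y
      proof -
        have "y \<in> ?U (A - {a})" using that a covered by blast
        then obtain b where "b \<in> A" "b \<noteq> a" "y \<in> J b" by blast
        then show ?thesis
          using x_in[of b] psubset.prems(3)[of b] unfolding independent_set_def by blast
      qed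
      obtain b where "b \<in> A" "b \<noteq> a" using other[of a] by blast
      then have "\<not> E x x"
        using x_in[of b] psubset.prems(3)[of b] unfolding independent_set_def by blast
      then have "independent_set E (insert x (J a))"
        using nonadj psubset.prems(3)[OF a] by (auto simp: independent_set_def)
      moreover have "c ` insert x (J a) = C"
        using psubset.prems(1,3) a x' by auto
      moreover have "insert x (J a) \<subseteq> ?U A" using a x' by auto
      ultimately show ?thesis by (intro exI conjI)
    qed
  qed
qed

text \<open>
  Greedy colouring of \<open>v\<close> with a colour chosen to preserve the invariant. The witnesses \<open>J a\<close> of
  failure avoid the neighbours of \<open>v\<close>, so each colour that these neighbours block also takes at
  least one vertex away from the room for witnesses. This is why the size condition of the
  exchange argument holds for the set \<open>A\<close> of free colours regardless of how many there are.
\<close>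

lemma colour_poor_extend:
  assumes fin: "finite F" and size: "card F + 3 \<le> 2 * k"
    and range: "c ` F \<subseteq> {..<k}" and poor: "colour_poor E k c F"
    and nbrs: "independent_set E {w \<in> F. E v w}"
  shows "\<exists>a<k. a \<notin> c ` {w \<in> F. E v w} \<and> colour_poor E k (c(v := a)) (insert v F)"
proof (rule ccontr)
  assume stuck: "\<not> ?thesis"
  let ?N = "{w \<in> F. E v w}"
  define A where "A = {..<k} - c ` ?N"
  have full: "c ` I \<noteq> {..<k}" if "I \<subseteq> F" "independent_set E I" for I
    using poor that unfolding colour_poor_def by (metis card_lessThan less_irrefl)
  have "\<exists>J \<subseteq> F - ?N. independent_set E J \<and> c ` J = {..<k} - {a}" if "a \<in> A" for a
  proof -
    have "\<not> colour_poor E k (c(v := a)) (insert v F)" "a < k"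
      using stuck that unfolding A_def by auto
    then obtain I where I: "I \<subseteq> insert v F" "independent_set E I" "k \<le> card ((c(v := a)) ` I)"
      unfolding colour_poor_def by (meson not_less)
    have "(c(v := a)) ` I \<subseteq> {..<k}"
      using I(1) range \<open>a < k\<close> by auto
    then have all: "(c(v := a)) ` I = {..<k}"
      using I(3) by (intro card_seteq) auto
    have sub: "I - {v} \<subseteq> F" using I(1) by blast
    have same: "c ` (I - {v}) = (c(v := a)) ` (I - {v})" by auto
    have ind: "independent_set E (I - {v})" using I(2) independent_set_subset by blast
    have "v \<in> I"
      using full[OF sub ind] same all by (metis Diff_empty Diff_insert0)
    then have "I - {v} \<subseteq> F - ?N"
      using sub I(2) unfolding independent_set_def by blast
    moreover have "c ` (I - {v}) = {..<k} - {a}"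
    proof -
      have "insert a (c ` (I - {v})) = {..<k}"
        using all \<open>v \<in> I\<close> same by (metis fun_upd_same image_insert insert_Diff)
      then show ?thesis using full[OF sub ind] by auto
    qed
    ultimately show ?thesis using ind by blast
  qed
  then have "\<forall>a\<in>A. \<exists>J. J \<subseteq> F - ?N \<and> independent_set E J \<and> c ` J = {..<k} - {a}"
    by blast
  from bchoice[OF this] obtain J where
    "\<forall>a\<in>A. J a \<subseteq> F - ?N \<and> independent_set E (J a) \<and> c ` J a = {..<k} - {a}" ..
  then have J: "J a \<subseteq> F - ?N" "independent_set E (J a)" "c ` J a = {..<k} - {a}" if "a \<in> A" for a
    using that by simp_all
  have cN: "card (c ` ?N) < k"
    using poor nbrs unfolding colour_poor_def by simp
  have cA: "card A = k - card (c ` ?N)"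
  proof -
    have "finite (c ` ?N)" "c ` ?N \<subseteq> {..<k}" using fin range by auto
    then show ?thesis unfolding A_def by (simp add: card_Diff_subset)
  qed
  have "card (\<Union>a\<in>A. J a) \<le> card (F - ?N)"
    using fin J(1) by (intro card_mono UN_least) auto
  also have "\<dots> = card F - card ?N"
    by (rule card_Diff_subset) (use fin in auto)
  finally have "card (\<Union>a\<in>A. J a) \<le> card F - card ?N" .
  moreover have "card ?N \<le> card F" "card (c ` ?N) \<le> card ?N"
    using fin by (auto intro: card_mono card_image_le)
  ultimately have "card (\<Union>a\<in>A. J a) + 3 \<le> card {..<k} + card A"
    using size cN cA by simp
  moreover have "A \<noteq> {}" using cA cN by auto
  moreover have "finite (J a)" if "a \<in> A" for a
    using J(1)[OF that] fin by (meson finite_Diff finite_subset)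
  ultimately obtain I where I: "I \<subseteq> (\<Union>a\<in>A. J a)" "independent_set E I" "c ` I = {..<k}"
    using rainbow_exchange[of "{..<k}" A J E c] J(2,3) by (auto simp: A_def)
  moreover have "(\<Union>a\<in>A. J a) \<subseteq> F" using J(1) by blast
  ultimately show False using full[of I] by (meson subset_trans)
qed

section \<open>Colouring along a zero forcing process\<close>

text \<open>
  \<open>S\<close> is the set of coloured vertices and \<open>F\<close> is meant to contain those of them that have
  uncoloured neighbours; only there is the invariant kept.
\<close>

definition frontier_colouring ::
    "('a \<Rightarrow> 'a \<Rightarrow> bool) \<Rightarrow> nat \<Rightarrow> 'a set \<Rightarrow> 'a set \<Rightarrow> ('a \<Rightarrow> nat) \<Rightarrow> bool" where
  "frontier_colouring E k S F c \<longleftrightarrow>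
     c ` S \<subseteq> {..<k} \<and> (\<forall>x\<in>S. \<forall>y\<in>S. E x y \<longrightarrow> c x \<noteq> c y) \<and> colour_poor E k c F"

locale triangle_free_relation =
  fixes E :: "'a \<Rightarrow> 'a \<Rightarrow> bool"
  assumes sym: "E x y \<Longrightarrow> E y x"
    and triangle_free: "E x y \<Longrightarrow> E y z \<Longrightarrow> \<not> E x z"
begin

lemma frontier_colouring_extend:
  assumes c: "frontier_colouring E k S F c" and "finite F" "F \<subseteq> S" "v \<notin> S"
    and size: "card F + 3 \<le> 2 * k"
    and sees: "\<And>x. x \<in> S \<Longrightarrow> E x v \<Longrightarrow> x \<in> F"
  shows "\<exists>c'. frontier_colouring E k (insert v S) (insert v F) c'"
proof -
  have "independent_set E {w \<in> F. E v w}"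
    using triangle_free[of v] by (auto simp: independent_set_def)
  then obtain a where a: "a < k" "a \<notin> c ` {w \<in> F. E v w}"
      "colour_poor E k (c(v := a)) (insert v F)"
    using colour_poor_extend[of F k c E v] c assms(2-4) size
    by (auto simp: frontier_colouring_def)
  have "c x \<noteq> a" if "x \<in> S" "E x v \<or> E v x" for x
    using that sees[of x] sym[of x v] sym[of v x] a(2) by auto
  moreover have "\<not> E v v" using triangle_free[of v v v] by blast
  ultimately have "frontier_colouring E k (insert v S) (insert v F) (c(v := a))"
    using c a \<open>v \<notin> S\<close> unfolding frontier_colouring_def by auto
  then show ?thesis by blast
qed

text \<open>
  The initial black set is its own frontier. Its vertices can be coloured one at a time, because
  the frontier present at each such step is a subset of \<open>B\<close>.
\<close>

lemma frontier_colouring_initial: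
  assumes "finite B" and "card B + 3 \<le> 2 * k"
  shows "\<exists>c. frontier_colouring E k B B c"
  using assms
proof (induction B)
  case empty
  then show ?case
    by (auto simp: frontier_colouring_def colour_poor_def)
next
  case (insert v B)
  then obtain c where "frontier_colouring E k B B c" by auto
  then show ?case
    using frontier_colouring_extend[of k B B c v] insert by simp
qed

end

text \<open>
  The size of the frontier never grows: a forcing vertex \<open>u\<close> has its last white neighbour \<open>v\<close>
  coloured and leaves. Before it leaves, \<open>v\<close> is coloured with \<open>u\<close> still present, since \<open>u\<close> is a
  neighbour of \<open>v\<close>.
\<close>

lemma zero_forcing_colouring:
  assumes "triangle_free_relation (dominates G)"
    and "finite B" and size: "card B + 3 \<le> 2 * k"
    and "(colour_change G)\<^sup>*\<^sup>* B S"
  shows "\<exists>F c. finite F \<and> F \<subseteq> S \<and> card F \<le> card B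
    \<and> (\<forall>x\<in>S. \<forall>y. x \<rightarrow>\<^bsub>G\<^esub> y \<longrightarrow> y \<notin> S \<longrightarrow> x \<in> F)
    \<and> frontier_colouring (dominates G) k S F c"
  using assms(4)
proof (induction rule: rtranclp_induct)
  case base
  have "\<exists>c. frontier_colouring (dominates G) k B B c"
    by (rule triangle_free_relation.frontier_colouring_initial) (fact assms)+
  then show ?case using assms(2) by auto
next
  case (step S S')
  from step.IH obtain F c where F: "finite F" "F \<subseteq> S" "card F \<le> card B"
      and sees: "\<And>x y. x \<in> S \<Longrightarrow> x \<rightarrow>\<^bsub>G\<^esub> y \<Longrightarrow> y \<notin> S \<Longrightarrow> x \<in> F"
      and c: "frontier_colouring (dominates G) k S F c"
    by blast
  from step.hyps(2) obtain u v where S': "S' = insert v S"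
      and u: "u \<in> S" "{w. u \<rightarrow>\<^bsub>G\<^esub> w \<and> w \<notin> S} = {v}"
    by (auto elim: colour_change.cases)
  then have v: "u \<rightarrow>\<^bsub>G\<^esub> v" "v \<notin> S" by auto
  then have "u \<in> F" using sees u(1) by blast
  have "\<exists>c'. frontier_colouring (dominates G) k (insert v S) (insert v F) c'"
    using triangle_free_relation.frontier_colouring_extend[OF assms(1) c F(1,2) v(2)]
      F(3) size sees v(2) by force
  then obtain c' where c': "frontier_colouring (dominates G) k (insert v S) (insert v F) c'"
    by blast
  let ?F = "insert v (F - {u})"
  have "frontier_colouring (dominates G) k (insert v S) ?F c'"
    using c' colour_poor_subset[of _ _ _ "insert v F" ?F] unfolding frontier_colouring_def by blast
  moreover have "card ?F \<le> card B"
    using F v(2) \<open>u \<in> F\<close> card_Suc_Diff1[of F u] by (auto simp: card_insert_if)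
  moreover have "\<forall>x\<in>insert v S. \<forall>y. x \<rightarrow>\<^bsub>G\<^esub> y \<longrightarrow> y \<notin> insert v S \<longrightarrow> x \<in> ?F"
    using sees u by blast
  ultimately show ?case unfolding S' using F by (intro exI[of _ ?F] exI[of _ c']) auto
qed

section \<open>The bound\<close>

lemma triangle_free_imp_no_triangle:
  assumes "graph G" "triangle_free G" "x \<rightarrow>\<^bsub>G\<^esub> y" "y \<rightarrow>\<^bsub>G\<^esub> z"
  shows "\<not> x \<rightarrow>\<^bsub>G\<^esub> z"
proof
  assume xz: "x \<rightarrow>\<^bsub>G\<^esub> z"
  interpret graph G by fact
  let ?H = "G \<restriction> {x, y, z}"
  have irrefl: "u \<noteq> v" if "u \<rightarrow>\<^bsub>G\<^esub> v" for u v
    using that adj_not_same by auto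
  have V: "{x, y, z} \<subseteq> verts G"
    using assms(3,4) xz by (auto dest: adj_in_verts)
  have ind: "induced_subgraph ?H G" using V by (rule induced_induce)
  then have "sym_digraph ?H" by (rule induced_graph_imp_graph)
  moreover have "digraph ?H" using ind by (rule digraphI_induced)
  ultimately have "graph ?H"
    by (simp add: graph_def pseudo_graph_def digraph_def)
  moreover have "card (verts ?H) = 3"
    using irrefl[OF assms(3)] irrefl[OF assms(4)] irrefl[OF xz] by simp
  moreover have "arcs_ends ?H = {(u, v). (u, v) \<in> verts ?H \<times> verts ?H \<and> u \<noteq> v}"
  proof -
    have "arcs_ends ?H = {(u, v). u \<rightarrow>\<^bsub>G\<^esub> v \<and> u \<in> {x, y, z} \<and> v \<in> {x, y, z}}"
      by (auto simp: arcs_ends_conv)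
    also have "\<dots> = {(u, v). (u, v) \<in> verts ?H \<times> verts ?H \<and> u \<noteq> v}"
      using irrefl assms(3,4) xz arcs_ends_symmetric[OF sym_arcs] by auto
    finally show ?thesis .
  qed
  ultimately have "K\<^bsub>3\<^esub> ?H" unfolding complete_digraph_def by blast
  then show False
    using assms(2) ind unfolding triangle_free_def by (blast dest: induced_imp_subgraph)
qed

theorem theorem4:
  fixes G :: "('a, 'b) pre_digraph"
  assumes "graph G" and "triangle_free G"
  shows "real (chromatic_number G) \<le> real (zero_forcing_number G) / 2 + 2"
proof -
  interpret graph G by fact
  have "zero_forcing_set G (verts G)"
    by (simp add: zero_forcing_set_def)
  then have "\<exists>k B. zero_forcing_set G B \<and> card B = k" by auto
  then have "\<exists>B. zero_forcing_set G B \<and> card B = zero_forcing_number G"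
    unfolding zero_forcing_number_def by (rule LeastI_ex)
  then obtain B where B: "zero_forcing_set G B" "card B = zero_forcing_number G"
    by auto
  \<comment> \<open>The least number with \<open>zero_forcing_number G + 3 \<le> 2 * k\<close>.\<close>
  define k where "k = zero_forcing_number G div 2 + 2"
  have "finite B"
    using B(1) finite_subset[OF _ finite_verts] unfolding zero_forcing_set_def by simp
  moreover have "card B + 3 \<le> 2 * k" unfolding B(2) k_def by simp
  moreover have "(colour_change G)\<^sup>*\<^sup>* B (verts G)"
    using B(1) unfolding zero_forcing_set_def by blast
  moreover have "triangle_free_relation (dominates G)"
  proof
    show "y \<rightarrow>\<^bsub>G\<^esub> x" if "x \<rightarrow>\<^bsub>G\<^esub> y" for x y
      using that by (rule arcs_ends_symmetric[OF sym_arcs])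
    show "\<not> x \<rightarrow>\<^bsub>G\<^esub> z" if "x \<rightarrow>\<^bsub>G\<^esub> y" "y \<rightarrow>\<^bsub>G\<^esub> z" for x y z
      using assms that by (rule triangle_free_imp_no_triangle)
  qed
  ultimately obtain F c where "frontier_colouring (dominates G) k (verts G) F c"
    using zero_forcing_colouring[of G B k "verts G"] by auto
  then have "proper_colouring G k c"
    unfolding proper_colouring_def frontier_colouring_def by simp (blast intro: adj_in_verts)
  then have "chromatic_number G \<le> k"
    unfolding chromatic_number_def by (intro Least_le exI)
  moreover have "2 * k \<le> zero_forcing_number G + 4" unfolding k_def by simp
  ultimately show ?thesis by linarith
qed

end
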